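(* Let $C=(c_{ij})$ and $C'=(c'_{ij})$ be real $n\times n$ matrices with row-sum vectors $(r_1,\ldots,r_n)$ and $(r'_1,\ldots,r'_n)$ respectively. Assume: (i) $c_{ij}\leq c'_{ij}$ for all $1\leq i\leq n$, $1\leq j\leq n-1$, and $r_i\leq r'_i$ for all $1\leq i\leq n$; (ii) $C'$ has a rooted eigenvector $v'=(v'_1,\ldots,v'_n)^T$ for an eigenvalue $\lambda'\in\mathbb{R}$; (iii) $C$ has a nonnegative left eigenvector $v^T=(v_1,\ldots,v_n)$ for an eigenvalue $\lambda\in\mathbb{R}$; (iv) $v^Tv'>0$. Then $\lambda\leq\lambda'$. Moreover, $\lambda=\lambda'$ if and only if both of the following hold: (a) if $v'_n\neq 0$, then $r_i=r'_i$ for all $1\le i\le n$ with $v_i\neq0$; (b) $c'_{ij}=c_{ij}$ for all $1\leq i\leq n$, $1\leq j\leq n-1$ with $v_i\neq 0$ and $v'_j>v'_n$.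
   Context: A real vector $(v_1,\ldots,v_n)$ is rooted if $v_i\geq v_n\geq 0$ for all $1\leq i\leq n-1$. The row-sum vector of a matrix is the vector of its row sums. *)

theory Defs
  imports "Jordan_Normal_Form.Char_Poly"
begin

text \<open>Vectors and matrices are indexed from 0, so the last entry of a vector \<open>v\<close> of
  dimension \<open>n\<close> is \<open>v $ (n - 1)\<close>.\<close>

definition rooted :: "real vec \<Rightarrow> bool" where
  "rooted v \<longleftrightarrow> 0 < dim_vec v
     \<and> (\<forall>i < dim_vec v - 1. v $ (dim_vec v - 1) \<le> v $ i)
     \<and> 0 \<le> v $ (dim_vec v - 1)"

definition row_sum_vec :: "real mat \<Rightarrow> real vec" where
  "row_sum_vec A = vec (dim_row A) (\<lambda>i. \<Sum>j < dim_col A. A $$ (i, j))"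

definition left_eigenvector :: "real mat \<Rightarrow> real vec \<Rightarrow> real \<Rightarrow> bool" where
  "left_eigenvector A v k \<longleftrightarrow> v \<in> carrier_vec (dim_row A) \<and> v \<noteq> 0\<^sub>v (dim_row A)
     \<and> mat_of_row v * A = k \<cdot>\<^sub>m mat_of_row v"

lemma left_eigenvector_transpose:
  assumes "A \<in> carrier_mat n n"
  shows "left_eigenvector A v k \<longleftrightarrow> eigenvector (transpose_mat A) v k"
proof -
  have "mat_of_row v * A = k \<cdot>\<^sub>m mat_of_row v \<longleftrightarrow> transpose_mat A *\<^sub>v v = k \<cdot>\<^sub>v v"
    if v: "v \<in> carrier_vec n"
  proof -
    have "mat_of_row v * A = k \<cdot>\<^sub>m mat_of_row v \<longleftrightarrow> (\<forall>j<n. v \<bullet> col A j = k * v $ j)"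
      using assms v by (auto simp: mat_eq_iff)
    also have "\<dots> \<longleftrightarrow> (\<forall>j<n. col A j \<bullet> v = k * v $ j)"
      using assms v by (metis carrier_matD(1) col_dim comm_scalar_prod)
    also have "\<dots> \<longleftrightarrow> transpose_mat A *\<^sub>v v = k \<cdot>\<^sub>v v"
      using assms v by (auto simp: vec_eq_iff)
    finally show ?thesis .
  qed
  then show ?thesis
    using assms by (auto simp: left_eigenvector_def eigenvector_def)
qed

end

theory Submission
  imports Defs
begin

text \<open>Let \<open>Q\<close> (\<open>rooting_mat\<close>) be the identity matrix with its last column replaced by ones. The
  last column of \<open>C Q\<close> is the row-sum vector of \<open>C\<close> and its other columns are those of \<open>C\<close>, so
  hypothesis (i) says exactly that \<open>C Q \<le> C' Q\<close> entrywise. Likewise \<open>v'\<close> is rooted if and only if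
  the vector \<open>u\<close> (\<open>rooting_coords v'\<close>) with \<open>v' = Q u\<close> is nonnegative. Pairing \<open>C' v' = l' v'\<close> with
  \<open>v\<close> and \<open>v\<^sup>T C = l v\<^sup>T\<close> with \<open>v'\<close> gives \<open>(l' - l) (v \<bullet> v') = v \<bullet> ((C' Q - C Q) u)\<close>, a sum of
  nonnegative terms. The comparison of \<open>l\<close> and \<open>l'\<close> works for any matrix in place of \<open>Q\<close>.\<close>

lemma all_less_iff_all_less_pred:
  fixes n :: nat
  assumes "1 \<le> n"
  shows "(\<forall>i<n. P i) \<longleftrightarrow> (\<forall>i<n-1. P i) \<and> P (n-1)"
  using assms by (cases n) (auto simp: All_less_Suc)

lemma zero_vec_le_iff: "0\<^sub>v n \<le> v \<longleftrightarrow> v \<in> carrier_vec n \<and> (\<forall>i<n. 0 \<le> v $ i)"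
  by (auto simp: less_eq_vec_def)

lemma zero_mat_le_iff:
  "0\<^sub>m m n \<le> A \<longleftrightarrow> A \<in> carrier_mat m n \<and> (\<forall>i<m. \<forall>j<n. 0 \<le> A $$ (i, j))"
  by (auto simp: less_eq_mat_def)

lemma scalar_prod_mult_mat_vec_eq_sum:
  fixes A :: "'a :: comm_semiring_0 mat"
  assumes "A \<in> carrier_mat m n" and "u \<in> carrier_vec n"
  shows "v \<bullet> (A *\<^sub>v u) = (\<Sum>i<m. \<Sum>j<n. v $ i * A $$ (i, j) * u $ j)"
  using assms by (simp add: scalar_prod_def lessThan_atLeast0 sum_distrib_left mult.assoc)

lemma
  fixes A :: "'a :: linordered_idom mat"
  assumes v: "0\<^sub>v m \<le> v" and A: "0\<^sub>m m n \<le> A" and u: "0\<^sub>v n \<le> u"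
  shows scalar_prod_mult_mat_vec_nonneg: "0 \<le> v \<bullet> (A *\<^sub>v u)"
    and scalar_prod_mult_mat_vec_eq_0_iff: "v \<bullet> (A *\<^sub>v u) = 0 \<longleftrightarrow>
      (\<forall>i<m. v $ i \<noteq> 0 \<longrightarrow> (\<forall>j<n. u $ j \<noteq> 0 \<longrightarrow> A $$ (i, j) = 0))"
proof -
  have eq_sum: "v \<bullet> (A *\<^sub>v u) = (\<Sum>i<m. \<Sum>j<n. v $ i * A $$ (i, j) * u $ j)"
    using A u by (simp add: scalar_prod_mult_mat_vec_eq_sum zero_mat_le_iff zero_vec_le_iff)
  have term_nonneg: "0 \<le> v $ i * A $$ (i, j) * u $ j" if "i < m" "j < n" for i j
    using that v A u by (simp add: zero_mat_le_iff zero_vec_le_iff)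
  have row_nonneg: "0 \<le> (\<Sum>j<n. v $ i * A $$ (i, j) * u $ j)" if "i < m" for i
    by (intro sum_nonneg) (use that term_nonneg in auto)
  show "0 \<le> v \<bullet> (A *\<^sub>v u)"
    unfolding eq_sum by (intro sum_nonneg row_nonneg) simp
  have "v \<bullet> (A *\<^sub>v u) = 0 \<longleftrightarrow> (\<forall>i<m. (\<Sum>j<n. v $ i * A $$ (i, j) * u $ j) = 0)"
    unfolding eq_sum by (subst sum_nonneg_eq_0_iff) (use row_nonneg in auto)
  also have "\<dots> \<longleftrightarrow> (\<forall>i<m. \<forall>j<n. v $ i * A $$ (i, j) * u $ j = 0)"
  proof -
    have "(\<Sum>j<n. v $ i * A $$ (i, j) * u $ j) = 0 \<longleftrightarrow>
        (\<forall>j<n. v $ i * A $$ (i, j) * u $ j = 0)" if "i < m" for i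
      by (subst sum_nonneg_eq_0_iff) (use that term_nonneg in auto)
    then show ?thesis
      by simp
  qed
  finally show "v \<bullet> (A *\<^sub>v u) = 0 \<longleftrightarrow>
      (\<forall>i<m. v $ i \<noteq> 0 \<longrightarrow> (\<forall>j<n. u $ j \<noteq> 0 \<longrightarrow> A $$ (i, j) = 0))"
    by auto
qed

lemma eigenvalue_diff_mult_scalar_prod:
  fixes A B :: "'a :: comm_ring_1 mat"
  assumes A: "A \<in> carrier_mat n n" and B: "B \<in> carrier_mat n n"
    and v: "eigenvector (transpose_mat A) v k" and w: "eigenvector B w l"
  shows "(l - k) * (v \<bullet> w) = v \<bullet> ((B - A) *\<^sub>v w)"
proof -
  have v_carrier: "v \<in> carrier_vec n" and w_carrier: "w \<in> carrier_vec n"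
    using v w A B by (auto simp: eigenvector_def)
  have "v \<bullet> (B *\<^sub>v w) = l * (v \<bullet> w)"
    using w v_carrier w_carrier by (simp add: eigenvector_def)
  moreover have "v \<bullet> (A *\<^sub>v w) = k * (v \<bullet> w)"
    using v transpose_vec_mult_scalar[OF A w_carrier v_carrier] v_carrier w_carrier
    by (simp add: eigenvector_def)
  moreover have "v \<bullet> ((B - A) *\<^sub>v w) = v \<bullet> (B *\<^sub>v w) - v \<bullet> (A *\<^sub>v w)"
    using A B v_carrier w_carrier
    by (simp add: minus_mult_distrib_mat_vec[OF B A w_carrier] scalar_prod_minus_distrib[of _ n])
  ultimately show ?thesis
    by (simp add: left_diff_distrib)
qed

lemma
  fixes C C' P :: "'a :: linordered_idom mat"
  assumes C: "C \<in> carrier_mat n n" and C': "C' \<in> carrier_mat n n" and P: "P \<in> carrier_mat n m"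
    and CP_le: "C * P \<le> C' * P"
    and left: "eigenvector (transpose_mat C) v l" and v: "0\<^sub>v n \<le> v"
    and right: "eigenvector C' w l'" and u: "0\<^sub>v m \<le> u" and w: "w = P *\<^sub>v u"
    and pos: "0 < v \<bullet> w"
  shows eigenvalue_le_if_mult_mat_le: "l \<le> l'"
    and eigenvalue_eq_iff_if_mult_mat_le: "l = l' \<longleftrightarrow>
      (\<forall>i<n. v $ i \<noteq> 0 \<longrightarrow> (\<forall>j<m. u $ j \<noteq> 0 \<longrightarrow> (C * P) $$ (i, j) = (C' * P) $$ (i, j)))"
proof -
  define D where "D = C' * P - C * P"
  have D_nonneg: "0\<^sub>m n m \<le> D"
    using C C' P CP_le by (simp add: D_def less_eq_mat_def)
  have "u \<in> carrier_vec m"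
    using u by (simp add: zero_vec_le_iff)
  then have "D *\<^sub>v u = (C' - C) *\<^sub>v w"
    unfolding D_def w minus_mult_distrib_mat[OF C' C P, symmetric]
    by (rule assoc_mult_mat_vec[OF minus_carrier_mat[OF C] P])
  then have diff: "(l' - l) * (v \<bullet> w) = v \<bullet> (D *\<^sub>v u)"
    using eigenvalue_diff_mult_scalar_prod[OF C C' left right] by simp
  then have "0 \<le> (l' - l) * (v \<bullet> w)"
    using scalar_prod_mult_mat_vec_nonneg[OF v D_nonneg u] by simp
  with pos show "l \<le> l'"
    by (simp add: zero_le_mult_iff)
  have "l = l' \<longleftrightarrow> v \<bullet> (D *\<^sub>v u) = 0"
    using pos by (auto simp flip: diff)
  also have "\<dots> \<longleftrightarrow> (\<forall>i<n. v $ i \<noteq> 0 \<longrightarrow> (\<forall>j<m. u $ j \<noteq> 0 \<longrightarrow> D $$ (i, j) = 0))"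
    by (rule scalar_prod_mult_mat_vec_eq_0_iff[OF v D_nonneg u])
  also have "\<dots> \<longleftrightarrow>
      (\<forall>i<n. v $ i \<noteq> 0 \<longrightarrow> (\<forall>j<m. u $ j \<noteq> 0 \<longrightarrow> (C * P) $$ (i, j) = (C' * P) $$ (i, j)))"
    using C C' P by (auto simp: D_def)
  finally show "l = l' \<longleftrightarrow>
      (\<forall>i<n. v $ i \<noteq> 0 \<longrightarrow> (\<forall>j<m. u $ j \<noteq> 0 \<longrightarrow> (C * P) $$ (i, j) = (C' * P) $$ (i, j)))" .
qed

definition rooting_mat :: "nat \<Rightarrow> 'a :: zero_neq_one mat" where
  "rooting_mat n = mat n n (\<lambda>(i, j). if j = i \<or> j = n - 1 then 1 else 0)"

definition rooting_coords :: "'a :: minus vec \<Rightarrow> 'a vec" where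
  "rooting_coords v = vec (dim_vec v)
     (\<lambda>i. if i = dim_vec v - 1 then v $ i else v $ i - v $ (dim_vec v - 1))"

lemma rooting_mat_carrier [simp]: "rooting_mat n \<in> carrier_mat n n"
  by (simp add: rooting_mat_def)

lemma rooting_mat_dim [simp]: "dim_row (rooting_mat n) = n" "dim_col (rooting_mat n) = n"
  by (simp_all add: rooting_mat_def)

lemma index_mult_rooting_mat:
  assumes A: "A \<in> carrier_mat m n" and i: "i < m" and j: "j < n"
  shows "(A * rooting_mat n) $$ (i, j) = (if j = n - 1 then row_sum_vec A $ i else A $$ (i, j))"
proof -
  have "col (rooting_mat n) j = (if j = n - 1 then vec n (\<lambda>_. 1 :: real) else unit_vec n j)"
    using j by (auto simp: rooting_mat_def)
  then show ?thesis
    using assms by (simp add: row_sum_vec_def scalar_prod_def[of _ "vec n _"] lessThan_atLeast0)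
qed

lemma mult_rooting_mat_le_iff:
  assumes A: "A \<in> carrier_mat m n" and B: "B \<in> carrier_mat m n" and n: "1 \<le> n"
  shows "A * rooting_mat n \<le> B * rooting_mat n \<longleftrightarrow>
    (\<forall>i<m. \<forall>j<n-1. A $$ (i, j) \<le> B $$ (i, j)) \<and> (\<forall>i<m. row_sum_vec A $ i \<le> row_sum_vec B $ i)"
proof -
  have "A * rooting_mat n \<le> B * rooting_mat n \<longleftrightarrow>
      (\<forall>i<m. \<forall>j<n. (A * rooting_mat n) $$ (i, j) \<le> (B * rooting_mat n) $$ (i, j))"
    using A B by (simp add: less_eq_mat_def)
  also have "\<dots> \<longleftrightarrow> (\<forall>i<m. (\<forall>j<n-1. A $$ (i, j) \<le> B $$ (i, j)) \<and>
      row_sum_vec A $ i \<le> row_sum_vec B $ i)"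
    using n by (simp add: all_less_iff_all_less_pred[OF n] index_mult_rooting_mat[OF A]
        index_mult_rooting_mat[OF B] del: index_mult_mat)
  finally show ?thesis
    by blast
qed

lemma rooting_mat_mult_rooting_coords:
  fixes v :: "'a :: ring_1 vec"
  assumes v: "v \<in> carrier_vec n"
  shows "rooting_mat n *\<^sub>v rooting_coords v = v"
proof
  fix i assume "i < dim_vec v"
  then have i: "i < n" using v by simp
  have "row (rooting_mat n) i =
      unit_vec n i + (if i = n - 1 then 0\<^sub>v n else unit_vec n (n - 1) :: 'a vec)"
    using i by (intro eq_vecI) (auto simp: rooting_mat_def)
  then show "(rooting_mat n *\<^sub>v rooting_coords v) $ i = v $ i"
    using v i by (simp add: rooting_coords_def add_scalar_prod_distrib[of _ n])
qed (use v in simp)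

lemma rooted_iff_zero_le_rooting_coords:
  "rooted v \<longleftrightarrow> 0 < dim_vec v \<and> 0\<^sub>v (dim_vec v) \<le> rooting_coords v"
proof (cases "1 \<le> dim_vec v")
  case True
  then show ?thesis
    by (auto simp: rooted_def rooting_coords_def zero_vec_le_iff all_less_iff_all_less_pred[OF True])
qed (simp add: rooted_def)

lemma mult_rooting_mat_eq_on_support_iff:
  assumes A: "A \<in> carrier_mat m n" and B: "B \<in> carrier_mat m n" and i: "i < m"
    and v: "v \<in> carrier_vec n" and rooted: "rooted v"
  shows "(\<forall>j<n. rooting_coords v $ j \<noteq> 0 \<longrightarrow>
      (A * rooting_mat n) $$ (i, j) = (B * rooting_mat n) $$ (i, j)) \<longleftrightarrow>
    (\<forall>j<n-1. v $ (n-1) < v $ j \<longrightarrow> A $$ (i, j) = B $$ (i, j)) \<and>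
    (v $ (n-1) \<noteq> 0 \<longrightarrow> row_sum_vec A $ i = row_sum_vec B $ i)"
proof -
  have n: "1 \<le> n" and dim: "dim_vec v = n"
    using v rooted by (auto simp: rooted_def)
  have "rooting_coords v $ (n-1) = v $ (n-1)"
    using n dim by (simp add: rooting_coords_def)
  moreover have "rooting_coords v $ j \<noteq> 0 \<longleftrightarrow> v $ (n-1) < v $ j" if "j < n-1" for j
  proof -
    have "v $ (n-1) \<le> v $ j"
      using that rooted dim by (simp add: rooted_def)
    then show ?thesis
      using that dim by (auto simp: rooting_coords_def)
  qed
  ultimately show ?thesis
    unfolding all_less_iff_all_less_pred[OF n] using n i
    by (simp add: index_mult_rooting_mat[OF A] index_mult_rooting_mat[OF B] del: index_mult_mat)
qed

theorem theorem3p4: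
  fixes n :: nat and C C' :: "real mat" and r r' v v' :: "real vec" and l l' :: real
  assumes n: "1 \<le> n"
    and C: "C \<in> carrier_mat n n" and C': "C' \<in> carrier_mat n n"
    and r: "r = row_sum_vec C" and r': "r' = row_sum_vec C'"
    and entries_le: "\<forall>i<n. \<forall>j<n-1. C $$ (i, j) \<le> C' $$ (i, j)"
    and row_sums_le: "\<forall>i<n. r $ i \<le> r' $ i"
    and v'_eigen: "eigenvector C' v' l'" and v'_rooted: "rooted v'"
    and v_eigen: "left_eigenvector C v l" and v_nonneg: "\<forall>i<n. 0 \<le> v $ i"
    and vv'_pos: "v \<bullet> v' > 0"
  shows "l \<le> l' \<and>
    (l = l' \<longleftrightarrow>
      (v' $ (n-1) \<noteq> 0 \<longrightarrow> (\<forall>i<n. v $ i \<noteq> 0 \<longrightarrow> r $ i = r' $ i)) \<and>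
      (\<forall>i<n. \<forall>j<n-1. v $ i \<noteq> 0 \<and> v' $ j > v' $ (n-1) \<longrightarrow> C' $$ (i, j) = C $$ (i, j)))"
proof -
  let ?Q = "rooting_mat n :: real mat" and ?u = "rooting_coords v'"
  have v': "v' \<in> carrier_vec n"
    using v'_eigen C' by (simp add: eigenvector_def)
  have v'_eq: "v' = ?Q *\<^sub>v ?u"
    by (simp add: rooting_mat_mult_rooting_coords[OF v'])
  have u_ge_0: "0\<^sub>v n \<le> ?u"
    using v'_rooted v' by (simp add: rooted_iff_zero_le_rooting_coords)
  have CQ_le: "C * ?Q \<le> C' * ?Q"
    using entries_le row_sums_le by (simp add: mult_rooting_mat_le_iff[OF C C' n] r r')
  have v_ge_0: "0\<^sub>v n \<le> v" and left: "eigenvector (transpose_mat C) v l"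
    using v_eigen v_nonneg C
    by (auto simp: zero_vec_le_iff eigenvector_def left_eigenvector_transpose[OF C])
  note comparison = C C' rooting_mat_carrier CQ_le left v_ge_0 v'_eigen u_ge_0 v'_eq vv'_pos
  have "l = l' \<longleftrightarrow> (\<forall>i<n. v $ i \<noteq> 0 \<longrightarrow>
      (\<forall>j<n. ?u $ j \<noteq> 0 \<longrightarrow> (C * ?Q) $$ (i, j) = (C' * ?Q) $$ (i, j)))"
    by (rule eigenvalue_eq_iff_if_mult_mat_le[OF comparison])
  also have "\<dots> \<longleftrightarrow> (\<forall>i<n. v $ i \<noteq> 0 \<longrightarrow>
      (\<forall>j<n-1. v' $ (n-1) < v' $ j \<longrightarrow> C $$ (i, j) = C' $$ (i, j)) \<and>
      (v' $ (n-1) \<noteq> 0 \<longrightarrow> r $ i = r' $ i))"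
    by (simp add: mult_rooting_mat_eq_on_support_iff[OF C C' _ v' v'_rooted] r r'
        del: index_mult_mat)
  finally show ?thesis
    using eigenvalue_le_if_mult_mat_le[OF comparison] by auto
qed

end
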